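(* Let $\gamma>1$ and $\theta_n=e^{-n^\gamma}$ for $n\ge1$. Then for every fixed $j\ge1$, as $n\to\infty$, \[ \mathbb{E}_n(R_j)=\exp\Bigl\{j\gamma\Bigl(\frac{\log n}{\gamma-1}\Bigr)^{\frac{\gamma-1}{\gamma}}+o\Bigl((\log n)^{\frac{\gamma-1}{\gamma}}\Bigr)\Bigr\}. \]
   Context: For $\sigma\in\mathcal{S}_n$ (permutations of $\{1,\dots,n\}$), $R_j(\sigma)$ is the number of cycles of length $j$. Given parameters $\theta_j\ge0$, $h_n=\frac1{n!}\sum_{\sigma\in\mathcal{S}_n}\prod_j\theta_j^{R_j(\sigma)}$ and $\mathbb{P}_n(\sigma)=\frac1{n!h_n}\prod_j\theta_j^{R_j(\sigma)}$, with expectation $\mathbb{E}_n$. *)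

theory Defs
  imports "HOL-Analysis.Analysis" "HOL-Combinatorics.Orbits" "HOL-Library.Landau_Symbols"
begin

definition perms :: "nat \<Rightarrow> (nat \<Rightarrow> nat) set" where
  "perms n = {\<sigma>. \<sigma> permutes {1..n}}"

definition cycle_count :: "nat \<Rightarrow> nat \<Rightarrow> (nat \<Rightarrow> nat) \<Rightarrow> nat" where
  "cycle_count n j \<sigma> = card {orbit \<sigma> x | x. x \<in> {1..n} \<and> card (orbit \<sigma> x) = j}"

text \<open>Weight prod_j theta_j ^ R_j(sigma); only j in {1..n} can have R_j > 0.\<close>
definition weight :: "(nat \<Rightarrow> real) \<Rightarrow> nat \<Rightarrow> (nat \<Rightarrow> nat) \<Rightarrow> real" where
  "weight \<theta> n \<sigma> = (\<Prod>j\<in>{1..n}. \<theta> j ^ cycle_count n j \<sigma>)"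

definition h_n :: "(nat \<Rightarrow> real) \<Rightarrow> nat \<Rightarrow> real" where
  "h_n \<theta> n = (1 / fact n) * (\<Sum>\<sigma>\<in>perms n. weight \<theta> n \<sigma>)"

definition P_n :: "(nat \<Rightarrow> real) \<Rightarrow> nat \<Rightarrow> (nat \<Rightarrow> nat) \<Rightarrow> real" where
  "P_n \<theta> n \<sigma> = weight \<theta> n \<sigma> / (fact n * h_n \<theta> n)"

definition E_n :: "(nat \<Rightarrow> real) \<Rightarrow> nat \<Rightarrow> ((nat \<Rightarrow> nat) \<Rightarrow> real) \<Rightarrow> real" where
  "E_n \<theta> n X = (\<Sum>\<sigma>\<in>perms n. P_n \<theta> n \<sigma> * X \<sigma>)"

end

theory Submission
  imports Defs "HOL-Real_Asymp.Real_Asymp"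
begin

text \<open>Fixing a point and summing over its cycle gives \<open>n h\<^sub>n = \<Sum>\<^sub>k \<theta>\<^sub>k h\<^sub>n\<^sub>-\<^sub>k\<close> and
  \<open>E\<^sub>n(R\<^sub>j) = (\<theta>\<^sub>j / j) h\<^sub>n\<^sub>-\<^sub>j / h\<^sub>n\<close>, so the growth of \<open>r\<^sub>n = h\<^sub>n / h\<^sub>n\<^sub>+\<^sub>1\<close> is needed up to a factor
  \<open>exp (o((log n)\<^sup>a))\<close>, \<open>a = (\<gamma> - 1) / \<gamma>\<close>. No saddle point analysis is required: since \<open>k \<mapsto> exp (- k\<^sup>\<gamma>)\<close> is
  log-concave, \<open>r\<^sub>n\<close> is nondecreasing and \<open>r\<^sub>n / (n + 1)\<close> is nonincreasing. Hence
  \<open>n \<le> \<Sum>\<^sub>k \<theta>\<^sub>k r\<^sub>n\<^sup>k\<close>, while \<open>n \<ge> \<theta>\<^sub>k (r\<^sub>n / 2)\<^sup>k\<close> for every \<open>k \<le> n / 2\<close>. With \<open>k\<close> near the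
  maximiser \<open>(log n / (\<gamma> - 1))\<^sup>1\<^sup>/\<^sup>\<gamma>\<close> of \<open>k log r\<^sub>n - k\<^sup>\<gamma>\<close>, both give
  \<open>log r\<^sub>n = \<gamma> (log n / (\<gamma> - 1))\<^sup>a + o((log n)\<^sup>a)\<close>.\<close>

section \<open>Cycle decomposition of weighted permutations\<close>

text \<open>The new map sends \<open>a\<close> to \<open>b\<close> and sends the
  \<open>p\<close>-preimage of \<open>b\<close> to \<open>a\<close>. So \<open>a\<close> is spliced
  into the cycle of \<open>b\<close> just before \<open>b\<close>.\<close>

lemma orbit_transpose_comp_new:
  assumes "finite S" "p permutes S" "a \<notin> S" "b \<in> S"
  shows "orbit (Transposition.transpose a b \<circ> p) a = insert a (orbit p b)"
proof -
  define s where "s = Transposition.transpose a b \<circ> p"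
  have "s permutes insert a S"
    unfolding s_def using assms
    by (intro permutes_compose permutes_swap_id permutes_subset[OF assms(2)]) auto
  then have "permutation s" "permutation p"
    using assms(1,2) by (auto simp: permutation_permutes)
  then have self: "x \<in> orbit s x" "x \<in> orbit p x" for x
    by (auto intro: permutation_self_in_orbit)
  have pa: "p a = a" and "a \<noteq> b"
    using assms by (auto simp: permutes_def)
  then have sa: "s a = b"
    by (simp add: s_def)
  have s: "s y = (if p y = b then a else p y)" if "y \<noteq> a" for y
  proof -
    have "p y \<noteq> a"
      using that pa permutes_inj[OF assms(2)] by (metis injD)
    then show ?thesis
      by (simp add: s_def Transposition.transpose_def)
  qed
  have "y \<in> insert a (orbit p b)" if "y \<in> orbit s a" for y
    using that
  proof induction
    case base
    then show ?case by (simp add: sa self)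
  next
    case (step y)
    then show ?case
      by (cases "y = a") (auto simp: sa s self intro: orbit.intros)
  qed
  moreover have b: "b \<in> orbit s a"
    using orbit.base[of s a] sa by simp
  have next_in: "p y \<in> orbit s a" if "y \<in> orbit s a" for y
    using orbit.step[OF that] s[of y] b self(1)[of a] pa that by (cases "y = a") (auto split: if_splits)
  have "y \<in> orbit s a" if "y \<in> orbit p b" for y
    using that by induction (auto intro: next_in b)
  ultimately show ?thesis
    using self(1)[of a] by (auto simp: s_def)
qed

lemma orbit_transpose_comp_old:
  assumes "finite S" "p permutes S" "a \<notin> S" "z \<in> S" "z \<notin> orbit p b"
  shows "orbit (Transposition.transpose a b \<circ> p) z = orbit p z"
proof (rule orbit_cong)
  have perm: "permutation p"
    using assms by (auto simp: permutation_permutes)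
  then show self: "z \<in> orbit p z"
    by (rule permutation_self_in_orbit)
  fix y assume y: "y \<in> orbit p z"
  then have py: "p y \<in> orbit p z"
    by (rule orbit.step)
  have "p y \<noteq> a"
    using permutes_orbit_subset[OF assms(2,4)] py assms(3) by auto
  moreover have "p y \<noteq> b"
    using orbit_swap[OF self py] assms(5) by auto
  ultimately show "(Transposition.transpose a b \<circ> p) y = p y"
    by (simp add: Transposition.transpose_def)
qed

text \<open>Outside the cycle of \<open>b\<close>, \<open>p\<close> never takes the value
  \<open>a\<close> or \<open>b\<close>, so the transposition changes nothing there. Only the cycle
  that receives \<open>a\<close> differs.\<close>

lemma orbits_transpose_comp:
  assumes "finite S" "p permutes S" "a \<notin> S" "b \<in> S"
  defines "s \<equiv> Transposition.transpose a b \<circ> p"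
  shows "orbit s ` insert a S - {orbit s a} = orbit p ` S - {orbit p b}"
proof -
  have "s permutes insert a S"
    unfolding s_def using assms
    by (intro permutes_compose permutes_swap_id permutes_subset[OF assms(2)]) auto
  then have perm: "permutation s" "permutation p"
    using assms(1,2) by (auto simp: permutation_permutes)
  then have self: "x \<in> orbit s x" "x \<in> orbit p x" for x
    by (auto intro: permutation_self_in_orbit)
  have new: "orbit s a = insert a (orbit p b)"
    unfolding s_def using assms by (intro orbit_transpose_comp_new)
  have same_s: "orbit s z = orbit s a" if "z \<in> orbit p b" for z
    using that new by (intro orbit_cyclic_eq3[OF cyclic_on_orbit'[OF perm(1)]]) auto
  have same_p: "orbit p z = orbit p b" if "z \<in> orbit p b" for z
    using that by (intro orbit_cyclic_eq3[OF cyclic_on_orbit'[OF perm(2)]]) auto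
  have old: "orbit s z = orbit p z" if "z \<in> S" "z \<notin> orbit p b" for z
    unfolding s_def using assms that by (intro orbit_transpose_comp_old)
  have "orbit p z \<noteq> orbit p b" "orbit p z \<noteq> orbit s a" if "z \<in> S" "z \<notin> orbit p b" for z
    using self(2)[of z] that new \<open>a \<notin> S\<close> by auto
  then have "orbit s ` insert a S - {orbit s a} = orbit p ` (S - orbit p b)"
    and "orbit p ` S - {orbit p b} = orbit p ` (S - orbit p b)"
    using same_s same_p old by (blast, blast)
  then show ?thesis
    by simp
qed

section \<open>Weight sums over arbitrary finite sets\<close>

definition orbit_weight :: "(nat \<Rightarrow> real) \<Rightarrow> 'a set \<Rightarrow> ('a \<Rightarrow> 'a) \<Rightarrow> real" where
  "orbit_weight \<theta> A \<sigma> = (\<Prod>C\<in>orbit \<sigma> ` A. \<theta> (card C))"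

text \<open>Stated for any set rather than \<open>{1..n}\<close>, because the induction below
  deletes arbitrary points.\<close>

definition total_weight :: "(nat \<Rightarrow> real) \<Rightarrow> 'a set \<Rightarrow> real" where
  "total_weight \<theta> A = (\<Sum>\<sigma> | \<sigma> permutes A. orbit_weight \<theta> A \<sigma>)"

text \<open>Leaving out the factor of the cycle through \<open>x\<close> makes the summand
  unaffected when that cycle is lengthened by a point, which gives a recursion in
  \<open>j\<close>.\<close>

definition pinned_weight :: "(nat \<Rightarrow> real) \<Rightarrow> 'a set \<Rightarrow> 'a \<Rightarrow> nat \<Rightarrow> real" where
  "pinned_weight \<theta> A x j = (\<Sum>\<sigma> | \<sigma> permutes A.
     if card (orbit \<sigma> x) = j then \<Prod>C\<in>orbit \<sigma> ` A - {orbit \<sigma> x}. \<theta> (card C) else 0)"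

lemma card_orbit_bounds:
  assumes "finite A" "\<sigma> permutes A" "x \<in> A"
  shows "card (orbit \<sigma> x) \<in> {1..card A}"
proof -
  have sub: "orbit \<sigma> x \<subseteq> A"
    using assms by (intro permutes_orbit_subset)
  then have "card (orbit \<sigma> x) \<noteq> 0"
    using orbit_nonempty[of \<sigma> x] assms(1) finite_subset[OF sub] by auto
  then show ?thesis
    using card_mono[OF assms(1) sub] by auto
qed

lemma pinned_weight_0:
  assumes "finite A" "x \<in> A"
  shows "pinned_weight \<theta> A x 0 = 0"
  unfolding pinned_weight_def using card_orbit_bounds[OF assms(1) _ assms(2)]
  by (intro sum.neutral) fastforce

lemma weight_of_orbit_length:
  assumes "finite A" "x \<in> A"
  shows "(\<Sum>\<sigma> | \<sigma> permutes A. if card (orbit \<sigma> x) = j then orbit_weight \<theta> A \<sigma> else 0) =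
    \<theta> j * pinned_weight \<theta> A x j"
  unfolding pinned_weight_def sum_distrib_left orbit_weight_def using assms
  by (intro sum.cong refl) (auto intro: prod.remove)

lemma total_weight_by_orbit_length:
  assumes "finite A" "x \<in> A"
  shows "total_weight \<theta> A = (\<Sum>j=1..card A. \<theta> j * pinned_weight \<theta> A x j)"
proof -
  have "total_weight \<theta> A = (\<Sum>\<sigma> | \<sigma> permutes A. \<Sum>j=1..card A.
          if card (orbit \<sigma> x) = j then orbit_weight \<theta> A \<sigma> else 0)"
    unfolding total_weight_def using card_orbit_bounds[OF assms(1) _ assms(2)]
    by (intro sum.cong refl) (auto simp: sum.delta)
  then show ?thesis
    by (subst (asm) sum.swap) (simp add: weight_of_orbit_length[OF assms])
qed

text \<open>Each permutation of \<open>insert a S\<close> is uniquely a permutation \<open>p\<close>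
  of \<open>S\<close>, or such a \<open>p\<close> with \<open>a\<close> spliced in before some
  \<open>b\<close>. In the first case \<open>a\<close> is a cycle of length 1; in the second the
  pinned cycle is that of \<open>b\<close>, one point longer.\<close>

lemma pinned_weight_insert:
  assumes "finite S" "a \<notin> S"
  shows "pinned_weight \<theta> (insert a S) a (Suc j) =
    (if j = 0 then total_weight \<theta> S else 0) + (\<Sum>b\<in>S. pinned_weight \<theta> S b j)"
proof -
  define f where "f \<sigma> = (if card (orbit \<sigma> a) = Suc j
    then \<Prod>C\<in>orbit \<sigma> ` insert a S - {orbit \<sigma> a}. \<theta> (card C) else 0)" for \<sigma>
  have fixed: "f p = (if j = 0 then orbit_weight \<theta> S p else 0)" if p: "p permutes S" for p
  proof -
    have "orbit p a = {a}"
      using p assms by (simp add: orbit_eq_singleton_iff permutes_def)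
    moreover have "{a} \<notin> orbit p ` S"
      using permutes_orbit_subset[OF p] assms(2) by auto
    ultimately show ?thesis
      by (auto simp: f_def orbit_weight_def)
  qed
  have moved: "f (Transposition.transpose a b \<circ> p) = (if card (orbit p b) = j
      then \<Prod>C\<in>orbit p ` S - {orbit p b}. \<theta> (card C) else 0)"
    if p: "p permutes S" and b: "b \<in> S" for p b
  proof -
    have "orbit p b \<subseteq> S"
      using p b by (rule permutes_orbit_subset)
    then have "card (insert a (orbit p b)) = Suc (card (orbit p b))"
      using assms finite_subset by (intro card_insert_disjoint) auto
    then show ?thesis
      using orbits_transpose_comp[OF assms(1) p assms(2) b]
        orbit_transpose_comp_new[OF assms(1) p assms(2) b] by (simp only: f_def) simp
  qed
  have "pinned_weight \<theta> (insert a S) a (Suc j) = (\<Sum>\<sigma> | \<sigma> permutes insert a S. f \<sigma>)"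
    by (simp add: pinned_weight_def f_def)
  also have "\<dots> = (\<Sum>p | p permutes S. f p) +
      (\<Sum>b\<in>S. \<Sum>p | p permutes S. f (Transposition.transpose a b \<circ> p))"
    using assms by (subst sum_over_permutations_insert) auto
  also have "(\<Sum>p | p permutes S. f p) = (if j = 0 then total_weight \<theta> S else 0)"
    by (simp add: fixed total_weight_def)
  also have "(\<Sum>b\<in>S. \<Sum>p | p permutes S. f (Transposition.transpose a b \<circ> p)) = (\<Sum>b\<in>S. pinned_weight \<theta> S b j)"
    unfolding pinned_weight_def by (intro sum.cong refl) (simp add: moved)
  finally show ?thesis .
qed

lemma weight_eq_orbit_weight:
  assumes "\<sigma> permutes {1..n}"
  shows "weight \<theta> n \<sigma> = orbit_weight \<theta> {1..n} \<sigma>"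
proof -
  have "(\<Prod>C\<in>orbit \<sigma> ` {1..n}. \<theta> (card C)) =
    (\<Prod>j\<in>{1..n}. \<Prod>C | C \<in> orbit \<sigma> ` {1..n} \<and> card C = j. \<theta> (card C))"
    using card_orbit_bounds[OF _ assms] by (intro prod.group[symmetric]) auto
  also have "\<dots> = (\<Prod>j\<in>{1..n}. \<theta> j ^ cycle_count n j \<sigma>)"
  proof (intro prod.cong refl)
    fix j
    have "{C \<in> orbit \<sigma> ` {1..n}. card C = j} = {orbit \<sigma> x |x. x \<in> {1..n} \<and> card (orbit \<sigma> x) = j}"
      by auto
    moreover have "(\<Prod>C | C \<in> orbit \<sigma> ` {1..n} \<and> card C = j. \<theta> (card C)) =
        (\<Prod>C | C \<in> orbit \<sigma> ` {1..n} \<and> card C = j. \<theta> j)"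
      by (intro prod.cong) auto
    ultimately show "(\<Prod>C | C \<in> orbit \<sigma> ` {1..n} \<and> card C = j. \<theta> (card C)) = \<theta> j ^ cycle_count n j \<sigma>"
      by (simp only: cycle_count_def prod_constant)
  qed
  finally show ?thesis
    by (simp add: weight_def orbit_weight_def)
qed

lemma total_weight_eq_h_n:
  "total_weight \<theta> {1..n} = fact n * h_n \<theta> n"
  by (simp add: total_weight_def h_n_def perms_def weight_eq_orbit_weight)

text \<open>Deleting the pinned point leaves \<open>m - 1\<close> choices for the next one, then
  \<open>m - 2\<close>, and so on, until a total weight on \<open>m - Suc j\<close> points remains;
  its factorial completes the product to \<open>fact (m - 1)\<close>. The assumption covers only
  smaller sets, so that the lemma can serve inside the strong induction for
  \<open>total_weight_eq\<close>.\<close>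

lemma pinned_weight_eq_of_smaller_total_weights:
  fixes A :: "nat set"
  assumes "\<And>B :: nat set. finite B \<Longrightarrow> card B < m \<Longrightarrow> total_weight \<theta> B = fact (card B) * h_n \<theta> (card B)"
    and "finite A" "card A = m" "x \<in> A" "j < m"
  shows "pinned_weight \<theta> A x (Suc j) = fact (m - 1) * h_n \<theta> (m - Suc j)"
  using assms
proof (induction j arbitrary: A x m)
  case 0
  have A: "A = insert x (A - {x})" and c: "card (A - {x}) = m - 1"
    using 0 by auto
  then have "total_weight \<theta> (A - {x}) = fact (m - 1) * h_n \<theta> (m - 1)"
    using "0.prems"(1)[of "A - {x}"] "0.prems"(2-5) c by auto
  then show ?case
    by (subst A, subst pinned_weight_insert) (use 0 in \<open>auto simp: pinned_weight_0\<close>)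
next
  case (Suc j)
  have A: "A = insert x (A - {x})" and c: "card (A - {x}) = m - 1"
    using Suc by auto
  have "pinned_weight \<theta> (A - {x}) b (Suc j) = fact (m - 2) * h_n \<theta> (m - Suc (Suc j))" if "b \<in> A - {x}" for b
    using Suc.IH[of "m - 1" "A - {x}" b] that c Suc.prems by (auto simp: numeral_2_eq_2)
  moreover have "fact (m - 1) = real (m - 1) * fact (m - 2)"
    using Suc.prems by (subst fact_reduce) (auto simp: numeral_2_eq_2)
  ultimately show ?case
    by (subst A, subst pinned_weight_insert) (use Suc.prems c in \<open>auto\<close>)
qed

lemma total_weight_eq:
  fixes A :: "nat set"
  assumes "finite A"
  shows "total_weight \<theta> A = fact (card A) * h_n \<theta> (card A)"
  using assms
proof (induction "card A" arbitrary: A rule: less_induct)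
  case less
  show ?case
  proof (cases "A = {}")
    case True
    then show ?thesis
      using total_weight_eq_h_n[of \<theta> 0] by simp
  next
    case False
    \<comment> \<open>The right-hand side depends on \<open>B\<close> only through its cardinality.
      Hence \<open>A\<close> and \<open>{1..card A}\<close> have the same total weight, without
      conjugating by a bijection.\<close>
    have eq: "total_weight \<theta> B = (\<Sum>j=1..card A. \<theta> j * (fact (card A - 1) * h_n \<theta> (card A - j)))"
      if B: "finite B" "card B = card A" for B :: "nat set"
    proof -
      obtain x where "x \<in> B"
        using B False less.prems by fastforce
      have "pinned_weight \<theta> B x j = fact (card A - 1) * h_n \<theta> (card A - j)" if "j \<in> {1..card A}" for j
        using pinned_weight_eq_of_smaller_total_weights[of "card A" \<theta> B x "j - 1"] less.hyps B \<open>x \<in> B\<close> that by auto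
      then show ?thesis
        using total_weight_by_orbit_length[OF B(1) \<open>x \<in> B\<close>] B(2) by simp
    qed
    have "total_weight \<theta> A = total_weight \<theta> {1..card A}"
      using eq[of A] eq[of "{1..card A}"] less.prems by simp
    then show ?thesis
      by (simp only: total_weight_eq_h_n)
  qed
qed

lemma pinned_weight_eq:
  assumes "x \<in> {1..n}" "j \<in> {1..n}"
  shows "pinned_weight \<theta> {1..n} x j = fact (n - 1) * h_n \<theta> (n - j)"
  using pinned_weight_eq_of_smaller_total_weights[of n \<theta> "{1..n}" x "j - 1"] assms total_weight_eq[of _ \<theta>] by auto

section \<open>Recursion for \<open>h_n\<close> and the expected cycle counts\<close>

lemma h_n_0: "h_n \<theta> 0 = 1"
  by (simp add: h_n_def perms_def weight_def)

lemma h_n_rec: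
  "real n * h_n \<theta> n = (\<Sum>k=1..n. \<theta> k * h_n \<theta> (n - k))"
proof (cases "n = 0")
  case False
  then have "fact n * h_n \<theta> n = fact (n - 1) * (\<Sum>k=1..n. \<theta> k * h_n \<theta> (n - k))"
    unfolding total_weight_eq_h_n[symmetric]
    by (subst total_weight_by_orbit_length[of _ 1])
       (simp_all add: pinned_weight_eq sum_distrib_left mult_ac del: One_nat_def)
  then show ?thesis
    using False by (simp add: fact_reduce[of n])
qed simp

lemma card_points_of_orbit_length:
  assumes "\<sigma> permutes {1..n}"
  shows "card {x \<in> {1..n}. card (orbit \<sigma> x) = j} = j * cycle_count n j \<sigma>"
proof -
  define K where "K = {orbit \<sigma> x |x. x \<in> {1..n} \<and> card (orbit \<sigma> x) = j}"
  have perm: "permutation \<sigma>"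
    using assms by (auto simp: permutation_permutes)
  note self = permutation_self_in_orbit[OF perm]
  have same: "orbit \<sigma> y = orbit \<sigma> x" if "y \<in> orbit \<sigma> x" for x y
    using that by (intro orbit_cyclic_eq3[OF cyclic_on_orbit'[OF perm]])
  have "j * card K = card (\<Union>K)"
  proof (rule card_partition)
    show "finite K"
      by (simp add: K_def)
    show "finite (\<Union>K)"
      using permutes_orbit_subset[OF assms]
      by (intro finite_subset[of "\<Union>K" "{1..n}"]) (auto simp: K_def)
    show "card c = j" if "c \<in> K" for c
      using that by (auto simp: K_def)
    show "c1 \<inter> c2 = {}" if "c1 \<in> K" "c2 \<in> K" "c1 \<noteq> c2" for c1 c2
      using that same unfolding K_def by blast
  qed
  moreover have "\<Union>K = {x \<in> {1..n}. card (orbit \<sigma> x) = j}"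
    using self same permutes_orbit_subset[OF assms] by (fastforce simp: K_def)
  ultimately show ?thesis
    by (simp add: cycle_count_def K_def)
qed

text \<open>Double counting: \<open>j\<close> times the number of \<open>j\<close>-cycles is the
  number of points on them, and all \<open>n\<close> points contribute the same pinned
  weight.\<close>

lemma E_n_cycle_count:
  assumes "j \<in> {1..n}"
  shows "E_n \<theta> n (\<lambda>\<sigma>. real (cycle_count n j \<sigma>)) = \<theta> j / real j * (h_n \<theta> (n - j) / h_n \<theta> n)"
proof -
  let ?S = "\<Sum>\<sigma> | \<sigma> permutes {1..n}. orbit_weight \<theta> {1..n} \<sigma> * real (cycle_count n j \<sigma>)"
  have "real j * ?S = (\<Sum>\<sigma> | \<sigma> permutes {1..n}. orbit_weight \<theta> {1..n} \<sigma> *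
      real (card {x \<in> {1..n}. card (orbit \<sigma> x) = j}))"
    unfolding sum_distrib_left by (intro sum.cong refl) (simp only: card_points_of_orbit_length mem_Collect_eq of_nat_mult mult_ac)
  also have "\<dots> = (\<Sum>\<sigma> | \<sigma> permutes {1..n}. \<Sum>x\<in>{1..n}.
      if card (orbit \<sigma> x) = j then orbit_weight \<theta> {1..n} \<sigma> else 0)"
    by (simp add: sum.If_cases Int_def conj_commute mult.commute)
  also have "\<dots> = (\<Sum>x\<in>{1..n}. \<theta> j * (fact (n - 1) * h_n \<theta> (n - j)))"
    by (subst sum.swap, intro sum.cong refl, subst weight_of_orbit_length)
       (simp_all add: pinned_weight_eq[OF _ assms] del: One_nat_def)
  also have "\<dots> = fact n * (\<theta> j * h_n \<theta> (n - j))"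
    using assms by (simp add: fact_reduce[of n])
  finally have "?S = fact n * (\<theta> j / real j * h_n \<theta> (n - j))"
    using assms by (simp add: field_simps)
  moreover have "E_n \<theta> n (\<lambda>\<sigma>. real (cycle_count n j \<sigma>)) = ?S / (fact n * h_n \<theta> n)"
    by (simp add: E_n_def P_n_def perms_def weight_eq_orbit_weight sum_divide_distrib)
  ultimately show ?thesis
    by simp
qed

section \<open>Log-concavity\<close>

text \<open>A Chebyshev-type inequality. Symmetrising the difference of the two sides over pairs
  \<open>(k, l)\<close> gives products of two factors that are both nonpositive for
  \<open>k \<le> l\<close> and both nonnegative for \<open>l \<le> k\<close>.\<close>

lemma sum_mult_le_sum_mult_of_tp2:
  fixes q u v :: "nat \<Rightarrow> real"
  assumes q: "\<And>k l. k \<le> l \<Longrightarrow> l \<le> n \<Longrightarrow> q l \<le> q k"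
    and uv: "\<And>k l. k \<le> l \<Longrightarrow> l \<le> n \<Longrightarrow> u k * v l \<le> u l * v k"
  shows "(\<Sum>k\<le>n. q k * u k) * (\<Sum>k\<le>n. v k) \<le> (\<Sum>k\<le>n. u k) * (\<Sum>k\<le>n. q k * v k)"
proof -
  define d where "d = (\<Sum>k\<le>n. \<Sum>l\<le>n. (q l - q k) * (u k * v l))"
  have "d = (\<Sum>k\<le>n. \<Sum>l\<le>n. (q k - q l) * (u l * v k))"
    unfolding d_def by (rule sum.swap)
  then have "2 * d = (\<Sum>k\<le>n. \<Sum>l\<le>n. (q l - q k) * (u k * v l - u l * v k))"
    by (simp add: d_def algebra_simps sum.distrib sum_subtractf)
  also have "\<dots> \<ge> 0"
  proof (intro sum_nonneg)
    fix k l assume "k \<in> {..n}" "l \<in> {..n}"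
    then show "0 \<le> (q l - q k) * (u k * v l - u l * v k)"
      using q[of k l] q[of l k] uv[of k l] uv[of l k]
      by (cases "k \<le> l") (auto intro: mult_nonneg_nonneg mult_nonpos_nonpos)
  qed
  also have "d = (\<Sum>k\<le>n. u k) * (\<Sum>k\<le>n. q k * v k) - (\<Sum>k\<le>n. q k * u k) * (\<Sum>k\<le>n. v k)"
    unfolding d_def sum_product by (simp add: algebra_simps sum_subtractf)
  finally show ?thesis
    by simp
qed

locale log_concave_weights =
  fixes w h :: "nat \<Rightarrow> real"
  assumes w_0: "w 0 = 1" and w_pos: "\<And>k. w k > 0"
    and w_log_concave: "\<And>k. w k * w (Suc (Suc k)) \<le> w (Suc k) ^ 2"
    and h_0: "h 0 = 1"
    and h_rec: "\<And>n. real n * h n = (\<Sum>k=1..n. w k * h (n - k))"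
begin

lemma h_pos: "h n > 0"
proof (induction n rule: less_induct)
  case (less n)
  show ?case
  proof (cases "n = 0")
    case False
    then have "(\<Sum>k=1..n. w k * h (n - k)) > 0"
      using less w_pos by (intro sum_pos) auto
    then have "real n * h n > 0"
      by (simp only: h_rec)
    then show ?thesis
      by (simp add: zero_less_mult_iff)
  qed (simp add: h_0)
qed

lemma weight_ratio_antimono:
  assumes "k \<le> l"
  shows "w (Suc l) / w l \<le> w (Suc k) / w k"
  using assms
proof (rule lift_Suc_antimono_le[of "\<lambda>k. w (Suc k) / w k", rotated])
  fix n
  show "w (Suc (Suc n)) / w (Suc n) \<le> w (Suc n) / w n"
    using w_log_concave[of n] w_pos[of n] w_pos[of "Suc n"]
    by (simp add: field_simps power2_eq_square)
qed

lemma h_rec_Suc: "real (Suc n) * h (Suc n) = (\<Sum>k\<le>n. w (Suc k) * h (n - k))"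
  unfolding h_rec One_nat_def sum.atLeast_Suc_atMost_Suc_shift atMost_atLeast0 by simp

text \<open>Since \<open>w 0 = 1\<close>, the term \<open>k = 0\<close> adds one more
  \<open>h n\<close> to the recursion. Together with \<open>h_rec_Suc\<close> this exhibits
  \<open>h (Suc n) / h n\<close> as an average of \<open>w (Suc k) / w k\<close>.\<close>

lemma h_rec_atMost: "real (Suc n) * h n = (\<Sum>k\<le>n. w k * h (n - k))"
  using h_rec[of n] w_0 by (simp add: atMost_atLeast0 sum.atLeast_Suc_atMost[of 0 n] algebra_simps)

text \<open>Log-concavity makes \<open>h m / h (Suc m)\<close> nondecreasing. It is assumed only
  below \<open>n\<close>, so that the induction proving it can use this lemma.\<close>

lemma h_cross_le_of_log_concave:
  assumes "\<And>m. Suc m < n \<Longrightarrow> h m * h (Suc (Suc m)) \<le> h (Suc m) ^ 2" "Suc a \<le> n" "a \<le> b" "Suc b \<le> n"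
  shows "h a * h (Suc b) \<le> h b * h (Suc a)"
  using assms(3,4)
proof (induction b rule: dec_induct)
  case (step b)
  then have "h a * h (Suc b) \<le> h b * h (Suc a)" "h b * h (Suc (Suc b)) \<le> h (Suc b) ^ 2"
    using assms(1)[of b] by auto
  then have "h a / h (Suc a) \<le> h b / h (Suc b)" "h b / h (Suc b) \<le> h (Suc b) / h (Suc (Suc b))"
    by (auto simp: field_simps h_pos power2_eq_square)
  then have "h a / h (Suc a) \<le> h (Suc b) / h (Suc (Suc b))"
    by linarith
  then show ?case
    by (simp add: field_simps h_pos)
qed simp

text \<open>The theorem of Bender and Canfield on cycle index polynomials: both consecutive quotients
  are averages of the nonincreasing \<open>w (k + 1) / w k\<close>, and the averaging measure for \<open>n + 1\<close>
  dominates the one for \<open>n\<close> in the likelihood ratio order.\<close>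

lemma h_log_concave: "h n * h (Suc (Suc n)) \<le> h (Suc n) ^ 2"
proof (induction n rule: less_induct)
  case (less n)
  define q where "q k = w (Suc k) / w k" for k
  define u where "u k = w k * h (Suc n - k)" for k
  \<comment> \<open>Extending by 0 at \<open>Suc n\<close> lets both averages run over the same
    range.\<close>
  define v where "v k = (if k \<le> n then w k * h (n - k) else 0)" for k
  have q: "q k * w k = w (Suc k)" for k
    using w_pos[of k] by (simp add: q_def)
  have "(\<Sum>k\<le>Suc n. q k * u k) * (\<Sum>k\<le>Suc n. v k) \<le> (\<Sum>k\<le>Suc n. u k) * (\<Sum>k\<le>Suc n. q k * v k)"
  proof (rule sum_mult_le_sum_mult_of_tp2)
    show "q l \<le> q k" if "k \<le> l" for k l
      unfolding q_def using that by (rule weight_ratio_antimono)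
    show "u k * v l \<le> u l * v k" if "k \<le> l" "l \<le> Suc n" for k l
    proof (cases "l \<le> n")
      case True
      \<comment> \<open>This is the likelihood ratio order:
        \<open>u k / v k = h (Suc n - k) / h (n - k)\<close> increases with \<open>k\<close> by the
        induction hypothesis.\<close>
      then have "h (n - l) * h (Suc (n - k)) \<le> h (n - k) * h (Suc (n - l))"
        using that less.IH by (intro h_cross_le_of_log_concave[of "Suc n"]) auto
      then have "(w k * w l) * (h (n - l) * h (Suc (n - k))) \<le> (w k * w l) * (h (n - k) * h (Suc (n - l)))"
        using w_pos[of k] w_pos[of l] by (intro mult_left_mono) auto
      then show ?thesis
        using True that by (simp add: u_def v_def Suc_diff_le mult_ac)
    next
      case False
      then show ?thesis
        using that w_pos[of l] w_pos[of k] h_pos by (auto simp: u_def v_def less_imp_le)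
    qed
  qed
  moreover have "(\<Sum>k\<le>Suc n. q k * u k) = real (Suc (Suc n)) * h (Suc (Suc n))"
    unfolding h_rec_Suc u_def mult.assoc[symmetric] q ..
  moreover have "(\<Sum>k\<le>Suc n. u k) = real (Suc (Suc n)) * h (Suc n)"
    unfolding h_rec_atMost u_def ..
  moreover have "(\<Sum>k\<le>Suc n. v k) = real (Suc n) * h n"
    unfolding h_rec_atMost by (simp add: v_def)
  moreover have "(\<Sum>k\<le>Suc n. q k * v k) = real (Suc n) * h (Suc n)"
    unfolding h_rec_Suc by (simp add: v_def q mult.assoc[symmetric])
  ultimately have "(real (Suc (Suc n)) * real (Suc n)) * (h n * h (Suc (Suc n))) \<le>
      (real (Suc (Suc n)) * real (Suc n)) * h (Suc n) ^ 2"
    by (simp add: power2_eq_square mult_ac)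
  then show ?case
    by (rule mult_left_le_imp_le) simp
qed

section \<open>Growth of consecutive quotients\<close>

definition ratio :: "nat \<Rightarrow> real" where
  "ratio n = h n / h (Suc n)"

lemma ratio_pos: "ratio n > 0"
  by (simp add: ratio_def h_pos)

lemma ratio_mono: "m \<le> n \<Longrightarrow> ratio m \<le> ratio n"
proof (rule lift_Suc_mono_le[of ratio])
  show "ratio n \<le> ratio (Suc n)" for n
    using h_log_concave[of n] by (simp add: ratio_def field_simps h_pos power2_eq_square)
qed

text \<open>The recursions for \<open>h (Suc n)\<close> and \<open>h (Suc (Suc n))\<close> are
  compared term by term through log-concavity. The result limits the growth of \<open>ratio\<close>
  to linear, so it at most doubles from \<open>m\<close> to \<open>m + k\<close> when
  \<open>k \<le> m\<close>.\<close>

lemma ratio_over_index_antimono: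
  assumes "m \<le> n"
  shows "ratio n / real (Suc n) \<le> ratio m / real (Suc m)"
proof (rule lift_Suc_antimono_le[of "\<lambda>n. ratio n / real (Suc n)", OF _ assms])
  fix n
  have "real (Suc n) * h (Suc n) * h (Suc n) = (\<Sum>k\<le>n. w (Suc k) * (h (n - k) * h (Suc n)))"
    by (simp only: h_rec_Suc sum_distrib_right mult.assoc)
  also have "\<dots> \<le> (\<Sum>k\<le>n. w (Suc k) * (h n * h (Suc n - k)))"
  proof (intro sum_mono mult_left_mono)
    fix k assume "k \<in> {..n}"
    then show "h (n - k) * h (Suc n) \<le> h n * h (Suc n - k)"
      using h_cross_le_of_log_concave[of "Suc n" "n - k" n] h_log_concave by (simp add: Suc_diff_le)
  qed (use w_pos in \<open>auto simp: less_imp_le\<close>)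
  also have "\<dots> \<le> (\<Sum>k\<le>Suc n. w (Suc k) * (h n * h (Suc n - k)))"
    using w_pos[of "Suc (Suc n)"] h_pos[of 0] h_pos[of n] by simp
  also have "\<dots> = h n * (real (Suc (Suc n)) * h (Suc (Suc n)))"
    by (simp only: h_rec_Suc sum_distrib_left mult_ac)
  finally have "real (Suc n) * h (Suc n) * h (Suc n) \<le> real (Suc (Suc n)) * h n * h (Suc (Suc n))"
    by (simp only: mult_ac)
  then show "ratio (Suc n) / real (Suc (Suc n)) \<le> ratio n / real (Suc n)"
    using h_pos[of "Suc n"] h_pos[of "Suc (Suc n)"]
    by (simp add: ratio_def divide_le_eq le_divide_eq mult_ac del: of_nat_Suc)
qed

lemma h_quotient_eq_prod: "h m / h (m + k) = (\<Prod>i<k. ratio (m + i))"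
proof (induction k)
  case (Suc k)
  then show ?case
    using h_pos[of "m + k"] by (simp add: ratio_def field_simps)
qed (use h_pos[of m] in simp)

lemma h_quotient_le: "h m / h (m + k) \<le> ratio (m + k) ^ k"
proof -
  have "(\<Prod>i<k. ratio (m + i)) \<le> (\<Prod>i<k. ratio (m + k))"
    by (intro prod_mono) (auto intro: ratio_mono simp: less_imp_le ratio_pos)
  then show ?thesis
    by (simp add: h_quotient_eq_prod)
qed

lemma h_quotient_ge:
  assumes "k \<le> m"
  shows "(ratio (m + k) / 2) ^ k \<le> h m / h (m + k)"
proof -
  have "ratio (m + k) / 2 \<le> ratio (m + i)" if "i < k" for i
  proof -
    have "ratio (m + k) / 2 = (real (Suc (m + k)) / 2) * (ratio (m + k) / real (Suc (m + k)))"
      by (simp add: divide_simps)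
    also have "\<dots> \<le> real (Suc m) * (ratio m / real (Suc m))"
      using assms ratio_pos[of "m + k"]
      by (intro mult_mono ratio_over_index_antimono) (auto simp: less_imp_le)
    also have "\<dots> \<le> ratio (m + i)"
      using ratio_mono[of m "m + i"] by simp
    finally show ?thesis .
  qed
  then have "(\<Prod>i<k. ratio (m + k) / 2) \<le> (\<Prod>i<k. ratio (m + i))"
    by (intro prod_mono) (auto simp: less_imp_le ratio_pos)
  then show ?thesis
    by (simp add: h_quotient_eq_prod)
qed

end

section \<open>Asymptotics\<close>

lemma powr_above_tangent:
  fixes c x p :: real
  assumes "p \<ge> 1" "c > 0" "x > 0"
  shows "c powr p + p * c powr (p - 1) * (x - c) \<le> x powr p"
proof -
  have "p * c powr (p - 1) * (x - c) \<le> x powr p - c powr p"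
    using assms
    by (intro convex_on_imp_above_tangent[OF powr_convex])
       (auto simp: interior_open intro!: derivative_eq_intros)
  then show ?thesis
    by simp
qed

lemma exp_neg_powr_log_concave:
  fixes p :: real
  assumes "p > 1"
  shows "exp (- (real k powr p)) * exp (- (real (Suc (Suc k)) powr p)) \<le> exp (- (real (Suc k) powr p)) ^ 2"
proof -
  have "2 * real (Suc k) powr p \<le> real k powr p + real (Suc (Suc k)) powr p"
  \<comment> \<open>For positive \<open>k\<close>, the tangent bounds at \<open>Suc k\<close> for
    its two neighbours add up and the linear terms cancel. The tangent bound excludes 0, where the
    claim is \<open>2 \<le> 2 powr p\<close>.\<close>
  proof (cases "k = 0")
    case True
    have "(2::real) powr 1 \<le> 2 powr p"
      using assms by (intro powr_mono) auto
    with True show ?thesis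
      by simp
  next
    case False
    then show ?thesis
      using powr_above_tangent[of p "real (Suc k)" "real k"]
        powr_above_tangent[of p "real (Suc k)" "real (Suc (Suc k))"] assms by simp
  qed
  then show ?thesis
    by (simp add: exp_add[symmetric] exp_double[symmetric] power2_eq_square)
qed

section \<open>Two-sided bounds for the logarithm of the ratio\<close>

locale exp_neg_powr_weights = log_concave_weights w h for w h +
  fixes \<gamma> :: real
  assumes \<gamma>: "\<gamma> > 1" and w_eq: "\<And>k. w k = exp (- (real k powr \<gamma>))"
begin

text \<open>With slope \<open>T = \<gamma> * peak n powr (\<gamma> - 1)\<close>, the function
  \<open>T * x - x powr \<gamma>\<close> is maximal at \<open>x = peak n\<close>, and its maximum is
  exactly \<open>ln n\<close>.\<close>

definition peak :: "nat \<Rightarrow> real" where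
  "peak n = (ln (real n) / (\<gamma> - 1)) powr (1 / \<gamma>)"

lemma peak_pos: "n \<ge> 2 \<Longrightarrow> peak n > 0"
  using \<gamma> by (simp add: peak_def)

lemma ln_eq_peak:
  assumes "n \<ge> 2"
  shows "ln (real n) = (\<gamma> - 1) * peak n powr \<gamma>"
  using assms \<gamma> by (simp add: peak_def powr_powr)

lemma peak_powr: "peak n powr (\<gamma> - 1) = (ln (real n) / (\<gamma> - 1)) powr ((\<gamma> - 1) / \<gamma>)"
  by (simp add: peak_def powr_powr)

text \<open>Were \<open>ln (ratio n)\<close> below \<open>T - 1\<close>, the tangent bound at
  \<open>peak n\<close> would give \<open>w k * ratio n ^ k \<le> n * exp (- k)\<close>. The
  recursion would then bound \<open>n * h n\<close> by itself times a geometric sum less than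
  1.\<close>

lemma ln_ratio_ge:
  assumes "n \<ge> 2"
  shows "\<gamma> * peak n powr (\<gamma> - 1) - 1 \<le> ln (ratio n)"
proof (rule ccontr)
  let ?T = "\<gamma> * peak n powr (\<gamma> - 1)"
  assume "\<not> ?T - 1 \<le> ln (ratio n)"
  then have less: "ln (ratio n) \<le> ?T - 1"
    by simp
  have "real n * h n = (\<Sum>k=1..n. w k * h (n - k))"
    by (rule h_rec)
  also have "\<dots> \<le> (\<Sum>k=1..n. (1 / 2) ^ k * real n * h n)"
  proof (intro sum_mono)
    fix k assume k: "k \<in> {1..n}"
    have "peak n powr (\<gamma> - 1) * peak n = peak n powr \<gamma>"
      using peak_pos[OF assms] by (simp add: powr_diff)
    then have "real k * ?T - real k powr \<gamma> \<le> (\<gamma> - 1) * peak n powr \<gamma>"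
      using powr_above_tangent[of \<gamma> "peak n" "real k"] k \<gamma> peak_pos[OF assms]
      by (simp add: algebra_simps)
    also have "\<dots> = ln (real n)"
      by (simp add: ln_eq_peak[OF assms])
    finally have "real k * ?T - real k powr \<gamma> \<le> ln (real n)" .
    moreover have "real k * ln (ratio n) \<le> real k * (?T - 1)"
      using less by (intro mult_left_mono) auto
    ultimately have "real k * ln (ratio n) - real k powr \<gamma> \<le> ln (real n) - real k"
      by (simp add: algebra_simps)
    then have "exp (real k * ln (ratio n) - real k powr \<gamma>) \<le> exp (ln (real n) - real k)"
      by simp
    also have "\<dots> = real n * exp (- 1) ^ k"
      using assms by (simp add: exp_diff exp_minus field_simps exp_of_nat_mult[symmetric])
    also have "\<dots> \<le> real n * (1 / 2) ^ k"
      using exp_ge_add_one_self[of 1] by (intro mult_left_mono power_mono) (auto simp: exp_minus field_simps)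
    finally have "w k * ratio n ^ k \<le> (1 / 2) ^ k * real n"
      by (simp add: w_eq exp_diff exp_of_nat_mult ratio_pos exp_minus field_simps)
    moreover have "h (n - k) \<le> ratio n ^ k * h n"
      using h_quotient_le[of "n - k" k] k h_pos[of n] by (simp add: field_simps)
    then have "w k * h (n - k) \<le> w k * ratio n ^ k * h n"
      using w_pos[of k] by simp
    ultimately show "w k * h (n - k) \<le> (1 / 2) ^ k * real n * h n"
      using h_pos[of n] by (smt (verit) mult_right_mono)
  qed
  also have "\<dots> = (\<Sum>k=1..n. (1 / 2) ^ k) * (real n * h n)"
    unfolding sum_distrib_right by (simp only: mult.assoc)
  also have "(\<Sum>k=1..n. (1 / 2 :: real) ^ k) = 1 - (1 / 2) ^ n"
    by (induction n) auto
  also have "(1 - (1 / 2) ^ n) * (real n * h n) < real n * h n"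
    using assms h_pos[of n] by (simp add: algebra_simps)
  finally show False
    by simp
qed

text \<open>A single term of the recursion is at most the whole sum; taking logarithms and dividing
  by \<open>k\<close> gives the bound. The condition \<open>2 * k \<le> n\<close> is what
  \<open>h_quotient_ge\<close> requires.\<close>

lemma ln_ratio_le_of_index:
  assumes "k \<ge> 1" "2 * k \<le> n"
  shows "ln (ratio n) \<le> ln 2 + ln (real n) / real k + real k powr (\<gamma> - 1)"
proof -
  have "w k * h (n - k) \<le> real n * h n"
    unfolding h_rec using assms w_pos h_pos
    by (intro member_le_sum) (auto simp: less_imp_le)
  moreover have "(ratio n / 2) ^ k * h n \<le> h (n - k)"
    using h_quotient_ge[of k "n - k"] assms h_pos[of n] by (simp add: field_simps)
  then have "w k * (ratio n / 2) ^ k * h n \<le> w k * h (n - k)"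
    using w_pos[of k] by simp
  ultimately have "w k * (ratio n / 2) ^ k * h n \<le> real n * h n"
    by linarith
  then have "w k * (ratio n / 2) ^ k \<le> real n"
    using h_pos[of n] by simp
  moreover have "w k * (ratio n / 2) ^ k > 0"
    by (simp add: w_pos ratio_pos)
  ultimately have "ln (w k * (ratio n / 2) ^ k) \<le> ln (real n)"
    by (subst ln_le_cancel_iff) auto
  then have "real k * (ln (ratio n) - ln 2) \<le> ln (real n) + real k powr \<gamma>"
    using ratio_pos[of n] w_pos[of k] by (simp add: ln_mult ln_realpow ln_div w_eq)
  moreover have "real k powr \<gamma> = real k * real k powr (\<gamma> - 1)"
    using assms by (simp add: powr_diff)
  ultimately show ?thesis
    using assms by (simp add: field_simps)
qed

lemma ln_ratio_le:
  assumes "n \<ge> 2" "2 * (peak n + 1) \<le> real n"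
  shows "ln (ratio n) \<le> ln 2 + (\<gamma> - 1) * peak n powr (\<gamma> - 1) + (peak n + 1) powr (\<gamma> - 1)"
proof -
  \<comment> \<open>Rounding up keeps \<open>ln n / k\<close> below its value at
    \<open>peak n\<close>; the only loss is in \<open>k powr (\<gamma> - 1)\<close>.\<close>
  define k where "k = nat \<lceil>peak n\<rceil>"
  have k: "peak n \<le> real k" "real k \<le> peak n + 1"
    using peak_pos[OF assms(1)] unfolding k_def by linarith+
  then have "real k > 0" "real (2 * k) \<le> real n"
    using peak_pos[OF assms(1)] assms(2) by auto
  then have "k \<ge> 1" "2 * k \<le> n"
    by (simp_all only: of_nat_le_iff of_nat_0_less_iff Suc_le_eq One_nat_def)
  then have "ln (ratio n) \<le> ln 2 + ln (real n) / real k + real k powr (\<gamma> - 1)"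
    by (rule ln_ratio_le_of_index)
  also have "ln (real n) / real k \<le> ln (real n) / peak n"
    using k peak_pos[OF assms(1)] assms(1) by (intro divide_left_mono) auto
  also have "ln (real n) / peak n = (\<gamma> - 1) * peak n powr (\<gamma> - 1)"
    using peak_pos[OF assms(1)] by (simp add: ln_eq_peak[OF assms(1)] powr_diff)
  also have "real k powr (\<gamma> - 1) \<le> (peak n + 1) powr (\<gamma> - 1)"
    using k \<gamma> by (intro powr_mono2) auto
  finally show ?thesis
    by simp
qed

text \<open>The cost of rounding \<open>peak n\<close> to an integer: of order
  \<open>peak n powr (\<gamma> - 2)\<close>, one power below the main term.\<close>

definition peak_increment :: "nat \<Rightarrow> real" where
  "peak_increment n = (peak n + 1) powr (\<gamma> - 1) - peak n powr (\<gamma> - 1)"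

text \<open>The quotient lies between the \<open>j\<close>-th powers of \<open>ratio n / 2\<close>
  and \<open>ratio n\<close>. The constant 2 covers the loss of 1 in \<open>ln_ratio_ge\<close> plus
  \<open>ln 2 \<le> 1\<close> from the halving.\<close>

lemma ln_quotient_bounds:
  assumes "n \<ge> 2" "2 * (peak n + 1) \<le> real n" "2 * j \<le> n"
  shows "\<bar>ln (h (n - j) / h n) - real j * \<gamma> * peak n powr (\<gamma> - 1)\<bar> \<le>
    real j * (2 + peak_increment n)"
proof -
  let ?d = "ln (ratio n) - \<gamma> * peak n powr (\<gamma> - 1)"
  have incr: "peak_increment n \<ge> 0"
    using \<gamma> peak_pos[OF assms(1)] unfolding peak_increment_def by (simp add: powr_mono2)
  have d: "- 1 \<le> ?d" "?d \<le> ln 2 + peak_increment n"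
    using ln_ratio_ge[OF assms(1)] ln_ratio_le[OF assms(1,2)]
    by (auto simp: peak_increment_def algebra_simps)
  have ln2: "ln (2::real) \<le> 1"
    using ln_le_minus_one[of 2] by simp
  have pos: "h (n - j) / h n > 0"
    by (simp add: h_pos)
  have "ln ((ratio n / 2) ^ j) \<le> ln (h (n - j) / h n)"
    using h_quotient_ge[of j "n - j"] assms(3) ratio_pos[of n] pos by (subst ln_le_cancel_iff) auto
  then have "real j * (ln (ratio n) - ln 2) \<le> ln (h (n - j) / h n)"
    using ratio_pos[of n] by (simp add: ln_realpow ln_div)
  moreover have "ln (h (n - j) / h n) \<le> ln (ratio n ^ j)"
    using h_quotient_le[of "n - j" j] assms(3) ratio_pos[of n] pos by (subst ln_le_cancel_iff) auto
  then have "ln (h (n - j) / h n) \<le> real j * ln (ratio n)"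
    using ratio_pos[of n] by (simp add: ln_realpow)
  moreover have "real j * (ln (ratio n) - ln 2) \<ge> real j * (\<gamma> * peak n powr (\<gamma> - 1) - (2 + peak_increment n))"
    using d ln2 incr by (intro mult_left_mono) auto
  moreover have "real j * ln (ratio n) \<le> real j * (\<gamma> * peak n powr (\<gamma> - 1) + (2 + peak_increment n))"
    using d ln2 incr by (intro mult_left_mono) auto
  ultimately show ?thesis
    by (simp add: algebra_simps abs_le_iff)
qed

lemma peak_increment_smallo: "peak_increment \<in> o(\<lambda>n. ln (real n) powr ((\<gamma> - 1) / \<gamma>))"
proof -
  have "\<gamma> > 0" "\<gamma> - 1 > 0"
    using \<gamma> by auto
  then show ?thesis
    unfolding peak_increment_def peak_def by real_asymp
qed

lemma eventually_peak_le: "\<forall>\<^sub>F n in at_top. 2 * (peak n + 1) \<le> real n"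
proof -
  have "\<gamma> > 0" "\<gamma> - 1 > 0"
    using \<gamma> by auto
  then show ?thesis
    unfolding peak_def by real_asymp
qed

lemma ln_quotient_smallo:
  "(\<lambda>n. ln (h (n - j) / h n) - real j * \<gamma> * peak n powr (\<gamma> - 1)) \<in> o(\<lambda>n. ln (real n) powr ((\<gamma> - 1) / \<gamma>))"
proof -
  have "(\<lambda>_. 2) \<in> o(\<lambda>n. ln (real n) powr ((\<gamma> - 1) / \<gamma>))"
  proof -
    have "(\<gamma> - 1) / \<gamma> > 0"
      using \<gamma> by simp
    then show ?thesis
      by real_asymp
  qed
  then have "(\<lambda>n. real j * (2 + peak_increment n)) \<in> o(\<lambda>n. ln (real n) powr ((\<gamma> - 1) / \<gamma>))"
    using peak_increment_smallo by (cases "j = 0") (auto intro: sum_in_smallo)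
  moreover have "\<forall>\<^sub>F n in at_top. \<bar>ln (h (n - j) / h n) - real j * \<gamma> * peak n powr (\<gamma> - 1)\<bar> \<le>
      real j * (2 + peak_increment n)"
    using eventually_peak_le eventually_ge_at_top[of 2] eventually_ge_at_top[of "2 * j"]
    by eventually_elim (rule ln_quotient_bounds)
  then have "(\<lambda>n. ln (h (n - j) / h n) - real j * \<gamma> * peak n powr (\<gamma> - 1)) \<in>
      O(\<lambda>n. real j * (2 + peak_increment n))"
    by (intro bigoI[of _ 1]) (auto elim!: eventually_mono)
  ultimately show ?thesis
    by (rule landau_o.big_small_trans[rotated])
qed

end

theorem theorem8p1:
  fixes \<gamma> :: real and \<theta> :: "nat \<Rightarrow> real" and j :: nat
  assumes "\<gamma> > 1"
    and "\<And>n. n \<ge> 1 \<Longrightarrow> \<theta> n = exp (- (real n powr \<gamma>))"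
    and "j \<ge> 1"
  shows "\<exists>\<epsilon> :: nat \<Rightarrow> real. \<epsilon> \<in> o(\<lambda>n. ln (real n) powr ((\<gamma> - 1) / \<gamma>)) \<and>
           (\<forall>\<^sub>F n in at_top. E_n \<theta> n (\<lambda>\<sigma>. real (cycle_count n j \<sigma>)) =
              exp (real j * \<gamma> * (ln (real n) / (\<gamma> - 1)) powr ((\<gamma> - 1) / \<gamma>) + \<epsilon> n))"
proof -
  \<comment> \<open>The hypotheses leave \<open>\<theta> 0\<close> arbitrary, but log-concavity needs \<open>w 0 = 1\<close>.\<close>
  define w where "w k = exp (- (real k powr \<gamma>))" for k
  interpret exp_neg_powr_weights w "h_n \<theta>" \<gamma>
  proof
    show "w k * w (Suc (Suc k)) \<le> w (Suc k) ^ 2" for k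
      unfolding w_def using assms(1) by (rule exp_neg_powr_log_concave)
    show "real n * h_n \<theta> n = (\<Sum>k=1..n. w k * h_n \<theta> (n - k))" for n
      unfolding h_n_rec by (intro sum.cong) (auto simp: assms(2) w_def)
  qed (use assms(1) in \<open>auto simp: w_def h_n_0\<close>)
  define c where "c = \<theta> j / real j"
  \<comment> \<open>The factor \<open>c\<close> does not depend on \<open>n\<close>, so its
    logarithm is absorbed into the error, whose scale tends to infinity.\<close>
  define \<epsilon> where "\<epsilon> n = ln c + (ln (h_n \<theta> (n - j) / h_n \<theta> n) - real j * \<gamma> * peak n powr (\<gamma> - 1))" for n
  have c: "c > 0"
    using assms by (simp add: c_def)
  have "(\<gamma> - 1) / \<gamma> > 0"
    using assms(1) by simp
  then have "(\<lambda>_. ln c) \<in> o(\<lambda>n. ln (real n) powr ((\<gamma> - 1) / \<gamma>))"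
    by real_asymp
  then have "\<epsilon> \<in> o(\<lambda>n. ln (real n) powr ((\<gamma> - 1) / \<gamma>))"
    unfolding \<epsilon>_def by (rule sum_in_smallo) (rule ln_quotient_smallo)
  moreover have "\<forall>\<^sub>F n in at_top. E_n \<theta> n (\<lambda>\<sigma>. real (cycle_count n j \<sigma>)) =
      exp (real j * \<gamma> * (ln (real n) / (\<gamma> - 1)) powr ((\<gamma> - 1) / \<gamma>) + \<epsilon> n)"
    using eventually_ge_at_top[of j]
  proof eventually_elim
    case (elim n)
    have "E_n \<theta> n (\<lambda>\<sigma>. real (cycle_count n j \<sigma>)) = c * (h_n \<theta> (n - j) / h_n \<theta> n)"
      unfolding c_def using elim assms(3) by (intro E_n_cycle_count) auto
    also have "\<dots> = exp (ln c + ln (h_n \<theta> (n - j) / h_n \<theta> n))"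
      using c by (simp add: exp_add h_pos)
    finally show ?case
      by (simp add: \<epsilon>_def peak_powr)
  qed
  ultimately show ?thesis
    by blast
qed

end
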